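(* Let $f_2:\mathbb{C}_2\times\mathbb{C}_2\to\mathbb{C}_1$ be defined by $f_2(\xi,\eta)=z_1\overline{w_1}+z_2\overline{w_2}$ for $\xi=z_1+i_2z_2$ and $\eta=w_1+i_2w_2$ (with $z_1,z_2,w_1,w_2\in\mathbb{C}_1$). Then: (a) $f_2(\xi,\xi)\ge 0$ for all $\xi\in\mathbb{C}_2$; (b) $f_2(\xi,\xi)=0$ if and only if $\xi=0$; (c) $\overline{f_2(\eta,\xi)}=f_2(\xi,\eta)$ for all $\xi,\eta\in\mathbb{C}_2$; (d) $f_2(\xi+\eta,\zeta)=f_2(\xi,\zeta)+f_2(\eta,\zeta)$ for all $\xi,\eta,\zeta\in\mathbb{C}_2$; (e) $f_2(\alpha\cdot\xi,\eta)=\alpha f_2(\xi,\eta)$ for all $\xi,\eta\in\mathbb{C}_2$ and all $\alpha\in\mathbb{C}_1$.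
   Context: $\mathbb{C}_0$ is the set of real numbers and $\mathbb{C}_1=\{a+i_1b: a,b\in\mathbb{C}_0\}$ the set of complex numbers, with complex conjugation written $\overline{\,\cdot\,}$. $\mathbb{C}_2$ is the set of bicomplex numbers $\xi=x_1+i_1x_2+i_2x_3+i_1i_2x_4$ with $x_1,\dots,x_4$ real, where $i_1^2=i_2^2=-1$ and $i_1i_2=i_2i_1$; it is a commutative algebra over $\mathbb{C}_1$ and over $\mathbb{C}_0$. Equivalently, and uniquely, $\xi=z_1+i_2z_2$ with $z_1=x_1+i_1x_2$, $z_2=x_3+i_1x_4\in\mathbb{C}_1$. Addition is componentwise, and for $\alpha\in\mathbb{C}_1$, $\alpha\cdot\xi=\alpha z_1+i_2\,\alpha z_2$. For a complex-valued expression, "$\ge 0$" means that it is a nonnegative real number. *)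

theory Defs
  imports "HOL-Analysis.Analysis"
begin

text \<open>
  Bicomplex numbers, following the library's construction of \<^typ>\<open>complex\<close>: \<open>Bicomplex z1 z2\<close> is
  \<open>z1 + i2 z2\<close>, where the imaginary unit \<open>i1\<close> is that of \<^typ>\<open>complex\<close>.
  The decomposition into \<open>z1\<close>, \<open>z2\<close> and the one into four real coordinates are recovered from the
  ring structure in \<open>Bicomplex_eq\<close> and \<open>Bicomplex_real_coords\<close> below.
\<close>

codatatype bicomplex = Bicomplex (bcfst: complex) (bcsnd: complex)

lemma bicomplex_surj [simp]: "Bicomplex (bcfst \<xi>) (bcsnd \<xi>) = \<xi>"
  by (rule bicomplex.collapse)

lemma bicomplex_eqI [intro?]: "bcfst \<xi> = bcfst \<eta> \<Longrightarrow> bcsnd \<xi> = bcsnd \<eta> \<Longrightarrow> \<xi> = \<eta>"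
  by (rule bicomplex.expand) simp

lemma bicomplex_eq_iff: "\<xi> = \<eta> \<longleftrightarrow> bcfst \<xi> = bcfst \<eta> \<and> bcsnd \<xi> = bcsnd \<eta>"
  by (auto intro: bicomplex_eqI)

instantiation bicomplex :: comm_ring_1
begin

primcorec zero_bicomplex where
  "bcfst 0 = 0"
| "bcsnd 0 = 0"

primcorec one_bicomplex where
  "bcfst 1 = 1"
| "bcsnd 1 = 0"

primcorec plus_bicomplex where
  "bcfst (\<xi> + \<eta>) = bcfst \<xi> + bcfst \<eta>"
| "bcsnd (\<xi> + \<eta>) = bcsnd \<xi> + bcsnd \<eta>"

primcorec uminus_bicomplex where
  "bcfst (- \<xi>) = - bcfst \<xi>"
| "bcsnd (- \<xi>) = - bcsnd \<xi>"

primcorec minus_bicomplex where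
  "bcfst (\<xi> - \<eta>) = bcfst \<xi> - bcfst \<eta>"
| "bcsnd (\<xi> - \<eta>) = bcsnd \<xi> - bcsnd \<eta>"

text \<open>Expansion of \<open>(z1 + i2 z2) (w1 + i2 w2)\<close> by commutativity and \<open>i2 ^ 2 = -1\<close>.\<close>

primcorec times_bicomplex where
  "bcfst (\<xi> * \<eta>) = bcfst \<xi> * bcfst \<eta> - bcsnd \<xi> * bcsnd \<eta>"
| "bcsnd (\<xi> * \<eta>) = bcfst \<xi> * bcsnd \<eta> + bcsnd \<xi> * bcfst \<eta>"

instance
  by standard (simp_all add: bicomplex_eq_iff algebra_simps)

end

instantiation bicomplex :: real_algebra_1
begin

primcorec scaleR_bicomplex where
  "bcfst (r *\<^sub>R \<xi>) = r *\<^sub>R bcfst \<xi>"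
| "bcsnd (r *\<^sub>R \<xi>) = r *\<^sub>R bcsnd \<xi>"

instance
  by standard (simp_all add: bicomplex_eq_iff algebra_simps)

end

primcorec scaleC :: "complex \<Rightarrow> bicomplex \<Rightarrow> bicomplex" (infixr "*\<^sub>C" 75) where
  "bcfst (\<alpha> *\<^sub>C \<xi>) = \<alpha> * bcfst \<xi>"
| "bcsnd (\<alpha> *\<^sub>C \<xi>) = \<alpha> * bcsnd \<xi>"

interpretation bicomplex: vector_space scaleC
  by standard (simp_all add: bicomplex_eq_iff algebra_simps)

lemma scaleC_mult_left: "(\<alpha> *\<^sub>C \<xi>) * \<eta> = \<alpha> *\<^sub>C (\<xi> * \<eta>)"
  and scaleC_mult_right: "\<xi> * (\<alpha> *\<^sub>C \<eta>) = \<alpha> *\<^sub>C (\<xi> * \<eta>)"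
  by (simp_all add: bicomplex_eq_iff algebra_simps)

lemma scaleC_of_real: "of_real r *\<^sub>C \<xi> = r *\<^sub>R \<xi>"
  by (simp add: bicomplex_eq_iff scaleR_conv_of_real[where 'a = complex])

definition bc_of_complex :: "complex \<Rightarrow> bicomplex" where
  "bc_of_complex z = Bicomplex z 0"

definition bc_i1 :: bicomplex where
  "bc_i1 = bc_of_complex \<i>"

definition bc_i2 :: bicomplex where
  "bc_i2 = Bicomplex 0 1"

lemma bc_of_complex_conv_scaleC: "bc_of_complex z = z *\<^sub>C 1"
  by (simp add: bc_of_complex_def bicomplex_eq_iff)

lemma bc_i1_squared: "bc_i1\<^sup>2 = - 1"
  by (simp add: bc_i1_def bc_of_complex_def power2_eq_square bicomplex_eq_iff)

lemma bc_i2_squared: "bc_i2\<^sup>2 = - 1"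
  by (simp add: bc_i2_def power2_eq_square bicomplex_eq_iff)

lemma Bicomplex_eq: "Bicomplex z1 z2 = bc_of_complex z1 + bc_i2 * bc_of_complex z2"
  by (simp add: bc_of_complex_def bc_i2_def bicomplex_eq_iff)

lemma Bicomplex_real_coords:
  "Bicomplex (Complex x1 x2) (Complex x3 x4) =
     of_real x1 + bc_i1 * of_real x2 + bc_i2 * of_real x3 + bc_i1 * bc_i2 * of_real x4"
  by (simp add: bc_of_complex_def bc_i1_def bc_i2_def bicomplex_eq_iff of_real_def complex_eq_iff)

definition f2 :: "bicomplex \<Rightarrow> bicomplex \<Rightarrow> complex" where
  "f2 \<xi> \<eta> = bcfst \<xi> * cnj (bcfst \<eta>) + bcsnd \<xi> * cnj (bcsnd \<eta>)"

end

theory Submission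
  imports Defs
begin

text \<open>
  Under the identification of \<open>z1 + i2 z2\<close> with \<open>(z1, z2)\<close>, the form \<^const>\<open>f2\<close> is the standard
  Hermitian inner product of the two-dimensional complex space. Its diagonal value is a sum of two
  squared moduli, which yields positivity and definiteness; Hermitian symmetry holds because
  conjugation is an involutive ring homomorphism, and linearity in the first argument because
  multiplication distributes over the componentwise operations.
\<close>

text \<open>
  Having the diagonal value in the form \<^const>\<open>of_real\<close> of a sum of squares reduces positivity and
  definiteness to statements about real numbers.
\<close>

lemma f2_self: "f2 \<xi> \<xi> = of_real ((cmod (bcfst \<xi>))\<^sup>2 + (cmod (bcsnd \<xi>))\<^sup>2)"
  by (simp add: f2_def complex_norm_square del: of_real_power)

lemma f2_self_nonneg: "f2 \<xi> \<xi> \<in> \<real>\<^sub>\<ge>\<^sub>0"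
  unfolding f2_self nonneg_Reals_of_real_iff by simp

lemma f2_self_eq_0_iff: "f2 \<xi> \<xi> = 0 \<longleftrightarrow> \<xi> = 0"
  unfolding f2_self of_real_eq_0_iff by (simp add: sum_power2_eq_zero_iff bicomplex_eq_iff)

lemma cnj_f2: "cnj (f2 \<eta> \<xi>) = f2 \<xi> \<eta>"
  by (simp add: f2_def mult.commute)

lemma f2_add_left: "f2 (\<xi> + \<eta>) \<zeta> = f2 \<xi> \<zeta> + f2 \<eta> \<zeta>"
  by (simp add: f2_def algebra_simps)

lemma f2_scaleC_left: "f2 (\<alpha> *\<^sub>C \<xi>) \<eta> = \<alpha> * f2 \<xi> \<eta>"
  by (simp add: f2_def algebra_simps)

theorem theorem2p5:
  shows "(\<forall>\<xi>. f2 \<xi> \<xi> \<in> \<real>\<^sub>\<ge>\<^sub>0)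
    \<and> (\<forall>\<xi>. f2 \<xi> \<xi> = 0 \<longleftrightarrow> \<xi> = 0)
    \<and> (\<forall>\<xi> \<eta>. cnj (f2 \<eta> \<xi>) = f2 \<xi> \<eta>)
    \<and> (\<forall>\<xi> \<eta> \<zeta>. f2 (\<xi> + \<eta>) \<zeta> = f2 \<xi> \<zeta> + f2 \<eta> \<zeta>)
    \<and> (\<forall>\<alpha> \<xi> \<eta>. f2 (\<alpha> *\<^sub>C \<xi>) \<eta> = \<alpha> * f2 \<xi> \<eta>)"
  by (intro conjI allI f2_self_nonneg f2_self_eq_0_iff cnj_f2 f2_add_left f2_scaleC_left)

end
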